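(* Let $d\ge 2$ be an integer and let $\mathbb{F}$ be a field with at least $\lfloor d/2\rfloor+d$ elements. Then every set $\mathcal{L}$ of lines in $\mathrm{PG}(d,\mathbb{F})$ which is a generator set with respect to hyperplanes contains at least $\lfloor d/2\rfloor+d$ lines.
   Context: A set $\mathcal{G}$ of points of $\mathrm{PG}(d,\mathbb{F})$ is a generator set with respect to hyperplanes if for every hyperplane $\Pi$ the set $\Pi\cap\mathcal{G}$ spans $\Pi$. A set $\mathcal{L}$ of lines is a generator set (with respect to hyperplanes) if the set of all points lying on lines of $\mathcal{L}$ is a generator set with respect to hyperplanes. *)

theory Defs
  imports "HOL-Analysis.Analysis"
begin

text \<open>The projective space PG(d,F) is the lattice of linear subspaces of the vector space
  \<^typ>\<open>'a ^ 'n\<close> over the field \<^typ>\<open>'a\<close>, where the index type has \<open>d + 1\<close> elements.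
  A projective subspace of projective dimension \<open>k\<close> is a linear subspace of linear
  dimension \<open>k + 1\<close>, and incidence is inclusion.\<close>

definition proj_subspace :: "nat \<Rightarrow> ('a::field ^ 'n) set \<Rightarrow> bool" where
  "proj_subspace k S \<longleftrightarrow> vec.subspace S \<and> vec.dim S = k + 1"

definition proj_points :: "('a::field ^ 'n) set set" where
  "proj_points = {P. proj_subspace 0 P}"

definition proj_lines :: "('a::field ^ 'n) set set" where
  "proj_lines = {l. proj_subspace 1 l}"

definition proj_hyperplanes :: "('a::field ^ 'n) set set" where
  "proj_hyperplanes = {H. vec.subspace H \<and> vec.dim H + 1 = CARD('n)}"

definition proj_span :: "('a::field ^ 'n) set set \<Rightarrow> ('a ^ 'n) set" where
  "proj_span X = vec.span (\<Union>X)"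

definition generator_set :: "('a::field ^ 'n) set set \<Rightarrow> bool" where
  "generator_set G \<longleftrightarrow> G \<subseteq> proj_points \<and>
     (\<forall>H \<in> proj_hyperplanes. proj_span {P \<in> G. P \<subseteq> H} = H)"

definition line_generator_set :: "('a::field ^ 'n) set set \<Rightarrow> bool" where
  "line_generator_set L \<longleftrightarrow> L \<subseteq> proj_lines \<and>
     generator_set {P \<in> proj_points. \<exists>l \<in> L. P \<subseteq> l}"

text \<open>Since \<^const>\<open>card\<close> is \<open>0\<close> on infinite sets, infinite sets are admitted explicitly.\<close>

definition has_at_least :: "nat \<Rightarrow> 'b set \<Rightarrow> bool" where
  "has_at_least m A \<longleftrightarrow> infinite A \<or> m \<le> card A"

end

theory Submission
  imports Defs
begin

text \<open>
  Fewer than \<open>\<lfloor>d/2\<rfloor> + d\<close> lines can all be met by a common subspace \<open>W\<close> of codimension 2: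
  \<open>\<lfloor>d/2\<rfloor>\<close> of them lie in a hyperplane \<open>H\<close>, each of the at most \<open>d - 1\<close> others has a point in \<open>H\<close>,
  and any \<open>W\<close> that contains these points and is a hyperplane of \<open>H\<close> also meets the lines inside \<open>H\<close>.
  A line not contained in \<open>W\<close> lies in at most one hyperplane through \<open>W\<close>. The field is so large
  that some hyperplane through \<open>W\<close> contains no line outside \<open>W\<close>; every line then meets
  this hyperplane inside \<open>W\<close> only, and its points on the lines do not span it.
\<close>

lemma subspace_between:
  fixes S T :: "('a::field ^ 'n) set"
  assumes "vec.subspace S" "vec.subspace T" "S \<subseteq> T" "vec.dim S \<le> k" "k \<le> vec.dim T"
  obtains U where "vec.subspace U" "S \<subseteq> U" "U \<subseteq> T" "vec.dim U = k"
proof -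
  from \<open>vec.dim S \<le> k\<close> \<open>k \<le> vec.dim T\<close>
  have "\<exists>U. vec.subspace U \<and> S \<subseteq> U \<and> U \<subseteq> T \<and> vec.dim U = k"
  proof (induction k rule: dec_induct)
    case base
    then show ?case using assms by blast
  next
    case (step k)
    then obtain U where U: "vec.subspace U" "S \<subseteq> U" "U \<subseteq> T" "vec.dim U = k"
      by auto
    with step.prems obtain x where x: "x \<in> T" "x \<notin> U"
      by (metis Suc_n_not_le_n subset_antisym subsetI)
    have "vec.span U = U"
      using U(1) by simp
    with x(2) U(4) have "vec.dim (vec.span (insert x U)) = Suc k"
      by (simp add: vec.dim_insert del: vec.span_eq_iff)
    moreover have "vec.span (insert x U) \<subseteq> T"
      using x U assms(2) by (intro vec.span_minimal) auto
    moreover have "S \<subseteq> vec.span (insert x U)"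
      using U(2) vec.span_superset by blast
    ultimately show ?case
      using vec.subspace_span by blast
  qed
  with that show thesis by blast
qed

text \<open>Grassmann's formula: \<open>S + T\<close> lies inside \<open>U\<close>, so the excess of
  \<open>vec.dim S + vec.dim T\<close> over \<open>vec.dim U\<close> must be absorbed by the
  intersection.\<close>

lemma dim_Int_gt:
  fixes S T U :: "('a::field ^ 'n) set"
  assumes "vec.subspace S" "vec.subspace T" "vec.subspace U" "S \<subseteq> U" "T \<subseteq> U"
    and "vec.dim U < vec.dim S + vec.dim T"
  shows "0 < vec.dim (S \<inter> T)"
proof -
  have "{x + y |x y. x \<in> S \<and> y \<in> T} \<subseteq> U"
    using assms(3-5) by (auto intro!: vec.subspace_add)
  then have "vec.dim {x + y |x y. x \<in> S \<and> y \<in> T} \<le> vec.dim U"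
    by (rule vec.dim_subset)
  with vec.dim_sums_Int[OF assms(1,2)] assms(6) show ?thesis by linarith
qed

text \<open>Bases of the members, taken together, span the union.\<close>

lemma dim_Union_le:
  fixes A :: "('a::field ^ 'n) set set"
  assumes "finite A" "\<And>l. l \<in> A \<Longrightarrow> vec.dim l \<le> k"
  shows "vec.dim (\<Union>A) \<le> k * card A"
proof -
  have "\<exists>B. B \<subseteq> l \<and> l \<subseteq> vec.span B \<and> finite B \<and> card B = vec.dim l"
    for l :: "('a ^ 'n) set"
    using vec.basis_exists[of l] vec.finiteI_independent by metis
  then obtain B where B: "\<And>l :: ('a ^ 'n) set. l \<subseteq> vec.span (B l)" "\<And>l. finite (B l)"
      "\<And>l. card (B l) = vec.dim l"
    by metis
  have "\<Union>A \<subseteq> vec.span (\<Union>l\<in>A. B l)"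
    using B(1) vec.span_mono[of "B _" "\<Union>l\<in>A. B l"] by blast
  then have "vec.dim (\<Union>A) \<le> card (\<Union>l\<in>A. B l)"
    using assms(1) B(2) by (intro vec.dim_le_card) auto
  also have "\<dots> \<le> (\<Sum>l\<in>A. card (B l))"
    using assms(1) by (rule card_UN_le)
  also have "\<dots> \<le> k * card A"
    using sum_bounded_above[of A "\<lambda>l. card (B l)" k] assms(2) B(3) by (simp add: mult.commute)
  finally show ?thesis .
qed

lemma codim2_meets_all_lines:
  fixes L :: "('a::field ^ 'n) set set"
  assumes "CARD('n) = d + 1" "1 \<le> d" "L \<subseteq> proj_lines" "finite L" "card L < d div 2 + d"
  obtains W where "vec.subspace W" "vec.dim W = d - 1" "\<And>l. l \<in> L \<Longrightarrow> 0 < vec.dim (l \<inter> W)"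
proof -
  have line: "vec.subspace l" "vec.dim l = 2" if "l \<in> L" for l
    using that assms(3) by (auto simp: proj_lines_def proj_subspace_def)
  have dimU: "vec.dim (UNIV :: ('a ^ 'n) set) = d + 1"
    using vec_dim_card assms(1) by metis
  \<comment> \<open>The bound \<open>d div 2\<close> ensures \<open>2 * card A \<le> d\<close>, so
    the lines of \<open>A\<close> fit into a hyperplane. The minimum covers the case that
    \<open>L\<close> has fewer lines than that; then \<open>A = L\<close>.\<close>
  obtain A where A: "A \<subseteq> L" "card A = min (card L) (d div 2)"
    using obtain_subset_with_card_n[of "min (card L) (d div 2)" L] by auto
  have finA: "finite A" using A(1) assms(4) finite_subset by blast
  have "vec.dim (\<Union>A) \<le> 2 * card A"
    using finA A(1) line by (intro dim_Union_le) auto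
  then have "vec.dim (vec.span (\<Union>A)) \<le> d"
    using A(2) by simp
  then obtain H where H: "vec.subspace H" "vec.span (\<Union>A) \<subseteq> H" "vec.dim H = d"
    using subspace_between[of "vec.span (\<Union>A)" UNIV d] dimU by auto
  have "\<exists>p. p \<in> l \<inter> H \<and> p \<noteq> 0" if "l \<in> L" for l
  proof -
    \<comment> \<open>The dimensions 2 and \<open>d\<close> add up to more than the
      \<open>d + 1\<close> of the whole space.\<close>
    have "0 < vec.dim (l \<inter> H)"
      using dim_Int_gt[of l H UNIV] line[OF that] H dimU by simp
    then have "\<not> l \<inter> H \<subseteq> {0}" by (metis less_irrefl vec.dim_eq_0)
    then show ?thesis by blast
  qed
  then obtain p where p: "\<And>l. l \<in> L \<Longrightarrow> p l \<in> l \<inter> H \<and> p l \<noteq> 0"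
    by metis
  have "vec.dim (vec.span (p ` (L - A))) \<le> card (L - A)"
    using vec.dim_le_card[of "p ` (L - A)" "p ` (L - A)"] card_image_le[of "L - A" p] assms(4)
    by (simp add: vec.span_superset)
  \<comment> \<open>Either \<open>L - A\<close> is empty or it has
    \<open>card L - d div 2 < d\<close> elements.\<close>
  also have "\<dots> \<le> d - 1"
    using A assms(4,5) finA by (simp add: card_Diff_subset)
  finally have "vec.dim (vec.span (p ` (L - A))) \<le> d - 1" .
  moreover have "vec.span (p ` (L - A)) \<subseteq> H"
    using H(1) p by (intro vec.span_minimal) auto
  ultimately obtain W where W: "vec.subspace W" "vec.span (p ` (L - A)) \<subseteq> W" "W \<subseteq> H"
      "vec.dim W = d - 1"
    using subspace_between[of "vec.span (p ` (L - A))" H "d - 1"] H by auto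
  have "0 < vec.dim (l \<inter> W)" if "l \<in> L" for l
  proof (cases "l \<in> A")
    case True
    then have "l \<subseteq> H" using H(2) vec.span_superset[of "\<Union>A"] by auto
    \<comment> \<open>Inside \<open>H\<close>, of dimension \<open>d\<close>, the dimensions 2 and
      \<open>d - 1\<close> of \<open>l\<close> and \<open>W\<close> again add up to one too
      many.\<close>
    then show ?thesis
      using dim_Int_gt[of l W H] line[OF that] W H assms(2) by simp
  next
    case False
    then have "p l \<in> l \<inter> W"
      using that p W(2) vec.span_superset[of "p ` (L - A)"] by auto
    moreover have "p l \<noteq> 0" using that p by blast
    ultimately have "\<not> l \<inter> W \<subseteq> {0}" by blast
    then show ?thesis by (metis gr0I vec.dim_eq_0)
  qed
  with that W show thesis by blast
qed

text \<open>The family omits one hyperplane of the pencil, which keeps the index type equal to the field.\<close>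

lemma pencil_of_hyperplanes:
  fixes W :: "('a::field ^ 'n) set"
  assumes "CARD('n) = d + 1" "1 \<le> d" "vec.subspace W" "vec.dim W = d - 1"
  obtains H :: "'a \<Rightarrow> ('a ^ 'n) set"
  where "\<And>c. H c \<in> proj_hyperplanes" "\<And>c. W \<subseteq> H c" "\<And>c e. c \<noteq> e \<Longrightarrow> H c \<inter> H e = W"
proof -
  have dimU: "vec.dim (UNIV :: ('a ^ 'n) set) = d + 1"
    using vec_dim_card assms(1) by metis
  have spanW: "vec.span W = W" using assms(3) by simp
  have "W \<noteq> UNIV" using dimU assms(2,4) by auto
  then obtain v where v: "v \<notin> W" by blast
  have dimv: "vec.dim (insert v W) = d"
    using v spanW assms(2,4) by (simp add: vec.dim_insert del: vec.span_eq_iff)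
  then have "vec.span (insert v W) \<noteq> UNIV"
    using dimU vec.dim_span[of "insert v W"] by (metis Suc_eq_plus1 n_not_Suc_n)
  then obtain u where u: "u \<notin> vec.span (insert v W)"
    by (metis UNIV_eq_I)
  have dimuv: "vec.dim (insert u (insert v W)) = d + 1"
    using u dimv by (simp add: vec.dim_insert del: vec.span_eq_iff)
  \<comment> \<open>Modulo \<open>W\<close>, the vectors \<open>u\<close> and \<open>v\<close> form
    a basis of a 2-dimensional space, whose 1-dimensional subspaces are the hyperplanes through
    \<open>W\<close>. The one omitted here is \<open>vec.span (insert v W)\<close>.\<close>
  define H where "H c = vec.span (insert (u + c *s v) W)" for c
  have out: "u + c *s v \<notin> W" for c
  proof
    assume "u + c *s v \<in> W"
    then have "(u + c *s v) - c *s v \<in> vec.span (insert v W)"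
      by (intro vec.span_diff vec.span_scale) (auto intro: vec.span_base)
    with u show False by simp
  qed
  have gen: "u + c *s v \<in> H c" for c
    unfolding H_def by (intro vec.span_base) simp
  have sub: "W \<subseteq> H c" for c
    unfolding H_def using vec.span_superset by blast
  have dimH: "vec.dim (H c) = d" for c
    using out[of c] spanW assms(2,4) by (simp add: H_def vec.dim_insert del: vec.span_eq_iff)
  have subH: "vec.subspace (H c)" for c
    by (simp add: H_def vec.subspace_span)
  have Int: "H c \<inter> H e = W" if "c \<noteq> e" for c e
  proof -
    \<comment> \<open>Otherwise \<open>H e\<close> contains both generators, hence their difference
      \<open>(c - e) *s v\<close>, hence \<open>v\<close> and \<open>u\<close>. Together with
      \<open>W\<close> these span the whole space, of dimension \<open>d + 1\<close>.\<close>
    have "H c \<inter> H e \<noteq> H c"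
    proof
      assume "H c \<inter> H e = H c"
      then have mem: "u + c *s v \<in> H e" "u + e *s v \<in> H e"
        using gen[of c] gen[of e] by blast+
      then have "(u + c *s v) - (u + e *s v) \<in> H e"
        using subH vec.subspace_diff by blast
      then have "(c - e) *s v \<in> H e"
        by (simp add: vec.scale_left_diff_distrib)
      then have "inverse (c - e) *s ((c - e) *s v) \<in> H e"
        by (rule vec.subspace_scale[OF subH])
      then have vH: "v \<in> H e"
        using that by (metis vec.scale_scale vec.scale_one left_inverse right_minus_eq)
      have "(u + e *s v) - e *s v \<in> H e"
        using vH mem subH by (intro vec.subspace_diff vec.subspace_scale)
      then have "insert u (insert v W) \<subseteq> H e"
        using vH sub by simp
      then show False
        using vec.dim_subset[of "insert u (insert v W)" "H e"] dimuv dimH[of e] by simp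
    qed
    moreover have subHI: "vec.subspace (H c \<inter> H e)"
      using subH by (intro vec.subspace_inter)
    ultimately have "vec.dim (H c \<inter> H e) < vec.dim (H c)"
      using vec.subspace_dim_equal[of "H c \<inter> H e" "H c"] subH by force
    \<comment> \<open>Being proper in \<open>H c\<close>, the intersection has dimension at most
      \<open>d - 1\<close>; since it contains \<open>W\<close>, which has this dimension, it equals
      \<open>W\<close>.\<close>
    then have "vec.dim (H c \<inter> H e) \<le> vec.dim W"
      using dimH assms(4) by simp
    then show ?thesis
      using vec.subspace_dim_equal[of W "H c \<inter> H e"] assms(3) sub subHI by simp
  qed
  have "H c \<in> proj_hyperplanes" for c
    using dimH subH assms(1) by (simp add: proj_hyperplanes_def)
  then show thesis using sub Int by (rule that)
qed

theorem mainTheorem4: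
  fixes d :: nat and L :: "('a::field ^ 'n) set set"
  assumes "d \<ge> 2"
    and "CARD('n) = d + 1"
    and "has_at_least (d div 2 + d) (UNIV :: 'a set)"
    and "line_generator_set L"
  shows "has_at_least (d div 2 + d) L"
proof (rule ccontr)
  assume "\<not> has_at_least (d div 2 + d) L"
  then have fin: "finite L" and card: "card L < d div 2 + d"
    by (auto simp: has_at_least_def)
  have L: "L \<subseteq> proj_lines"
    using assms(4) by (simp add: line_generator_set_def)
  have d: "1 \<le> d" using assms(1) by simp
  obtain W where W: "vec.subspace W" "vec.dim W = d - 1" "\<And>l. l \<in> L \<Longrightarrow> 0 < vec.dim (l \<inter> W)"
    using codim2_meets_all_lines[OF assms(2) d L fin card] by blast
  obtain H :: "'a \<Rightarrow> ('a ^ 'n) set" where H: "\<And>c. H c \<in> proj_hyperplanes" "\<And>c. W \<subseteq> H c"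
      "\<And>c e. c \<noteq> e \<Longrightarrow> H c \<inter> H e = W"
    using pencil_of_hyperplanes[OF assms(2) d W(1,2)] by blast
  have "\<exists>c. \<forall>l\<in>L. l \<subseteq> H c \<longrightarrow> l \<subseteq> W"
  proof (rule ccontr)
    assume "\<nexists>c. \<forall>l\<in>L. l \<subseteq> H c \<longrightarrow> l \<subseteq> W"
    then obtain f where f: "\<And>c. f c \<in> L \<and> f c \<subseteq> H c \<and> \<not> f c \<subseteq> W"
      by metis
    \<comment> \<open>A line chosen for two distinct parameters would lie in
      \<open>H c \<inter> H e = W\<close>. Injectivity then bounds the size of the field by
      \<open>card L\<close>, which also excludes an infinite field.\<close>
    have "inj f"
      by (rule injI) (metis f H(3) Int_subset_iff)
    moreover have "range f \<subseteq> L" using f by blast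
    ultimately have "finite (UNIV :: 'a set)" "CARD('a) \<le> card L"
      using fin by (auto intro: inj_on_finite card_inj_on_le)
    with assms(3) card show False by (simp add: has_at_least_def)
  qed
  then obtain c where c: "\<And>l. l \<in> L \<Longrightarrow> l \<subseteq> H c \<Longrightarrow> l \<subseteq> W" by blast
  have hyp: "vec.subspace (H c)" "vec.dim (H c) = d"
    using H(1)[of c] assms(2) by (auto simp: proj_hyperplanes_def)
  have meet: "l \<inter> H c \<subseteq> W" if l: "l \<in> L" for l
  proof (cases "l \<subseteq> H c")
    case True
    with c l show ?thesis by blast
  next
    case False
    have subl: "vec.subspace l" "vec.dim l = 2"
      using l L by (auto simp: proj_lines_def proj_subspace_def)
    have sub: "vec.subspace (l \<inter> H c)" "vec.subspace (l \<inter> W)"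
      using subl hyp W(1) by (auto intro: vec.subspace_inter)
    \<comment> \<open>The nested subspaces \<open>l \<inter> W\<close> and
      \<open>l \<inter> H c\<close> now have dimension at least 1 and at most 1 respectively, so
      they coincide.\<close>
    have "vec.dim (l \<inter> H c) < 2"
      using False subl sub vec.subspace_dim_equal[of "l \<inter> H c" l] by force
    with W(3)[OF l] have "l \<inter> W = l \<inter> H c"
      using sub H(2)[of c] by (intro vec.subspace_dim_equal) auto
    then show ?thesis by blast
  qed
  define G where "G = {P \<in> proj_points. \<exists>l \<in> L. P \<subseteq> l}"
  have "generator_set G"
    using assms(4) by (simp add: line_generator_set_def G_def)
  then have "proj_span {P \<in> G. P \<subseteq> H c} = H c"
    using H(1)[of c] by (simp add: generator_set_def)
  \<comment> \<open>A point in \<open>H c\<close> on some line \<open>l\<close> of \<open>L\<close>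
    lies in \<open>l \<inter> H c\<close>, so all such points span at most \<open>W\<close>, one
    dimension short of \<open>H c\<close>.\<close>
  moreover have "\<Union>{P \<in> G. P \<subseteq> H c} \<subseteq> W"
    using meet by (fastforce simp: G_def)
  then have "proj_span {P \<in> G. P \<subseteq> H c} \<subseteq> W"
    unfolding proj_span_def using W(1) by (rule vec.span_minimal)
  ultimately have "d \<le> d - 1"
    using vec.dim_subset[of "H c" W] hyp W(2) by simp
  with d show False by simp
qed

end
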